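(* Suppose $\|s_{opt}\|=\|s_k\|=\Delta$. Then for $k=0,1,\ldots,k_{\max}$ we have $$\|(A+\lambda_kI)s_k+g\|\le(\lambda_{opt}-\lambda_k)\Delta+(\alpha_1+\lambda_{opt})\|s_{opt}-s_k\|$$ by dropping the higher order small term $(\lambda_{opt}-\lambda_k)\|s_{opt}-s_k\|$; i.e. the inequality holds up to adding the term $(\lambda_{opt}-\lambda_k)\|s_{opt}-s_k\|$ to its right-hand side.
   Context: $\|\cdot\|$ is the 2-norm. $A\in\mathbb R^{n\times n}$ is symmetric and nonsingular with eigenvalues $\alpha_1\ge\alpha_2\ge\cdots\ge\alpha_n$, $g\in\mathbb R^n$ is nonzero, $\Delta>0$, and $q(s)=g^Ts+\frac12 s^TAs$. The trust-region subproblem (TRS) is $\min_{\|s\|\le\Delta}q(s)$; $s_{opt}$ is its solution and $\lambda_{opt}\ge0$ its optimal Lagrangian multiplier: $\|s_{opt}\|\le\Delta$, $(A+\lambda_{opt}I)s_{opt}=-g$, $\lambda_{opt}(\Delta-\|s_{opt}\|)=0$, $A+\lambda_{opt}I\succeq0$. Standing assumption (easy case): $A+\lambda_{opt}I\succ0$, so $s_{opt}$ is unique. $\mathcal S_k=\mathcal K_k(g,A)=\mathrm{span}\{g,Ag,\ldots,A^kg\}$. $k_{\max}$ is the first iteration at which the symmetric Lanczos process breaks down, i.e. the largest $k$ with $\dim\mathcal S_k=k+1$. For $0\le k\le k_{\max}$, $Q_k$ is the matrix with orthonormal columns produced by the symmetric Lanczos process started at $g/\|g\|$; its columns form an orthonormal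 basis of $\mathcal S_k$, and $T_k=Q_k^TAQ_k$. $\beta_0=\|g\|$ and $e_1$ is the first column of the identity matrix. $s_k=Q_kh_k$ solves $\min_{s\in\mathcal S_k,\|s\|\le\Delta}q(s)$; equivalently $h_k$ solves $\min_{\|h\|\le\Delta}\beta_0e_1^Th+\frac12h^TT_kh$, with optimal Lagrangian multiplier $\lambda_k\ge0$: $\|h_k\|\le\Delta$, $(T_k+\lambda_kI)h_k=-\beta_0e_1$, $\lambda_k(\Delta-\|h_k\|)=0$, $T_k+\lambda_kI\succeq0$. Standing assumption: $\|s_k\|=\Delta$ and $\lambda_k>0$ for all $k=0,1,\ldots,k_{\max}$. It is known that $\lambda_k\le\lambda_{opt}$. *)

theory Defs
  imports "HOL-Analysis.Analysis"
begin

text \<open>Matrices are not required to be symmetric here; symmetry is a separate assumption.\<close>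

definition pos_def :: "real^'n^'n \<Rightarrow> bool" where
  "pos_def M \<longleftrightarrow> (\<forall>x. x \<noteq> 0 \<longrightarrow> x \<bullet> (M *v x) > 0)"

definition pos_semidef :: "real^'n^'n \<Rightarrow> bool" where
  "pos_semidef M \<longleftrightarrow> (\<forall>x. x \<bullet> (M *v x) \<ge> 0)"

text \<open>\<open>\<alpha> 1 \<ge> \<dots> \<ge> \<alpha> n\<close> are the eigenvalues of \<open>M\<close>, listed with multiplicity as the roots of
  the characteristic polynomial; \<open>mat x\<close> is \<open>x\<close> times the identity matrix.\<close>

definition ordered_eigenvalues :: "real^'n^'n \<Rightarrow> (nat \<Rightarrow> real) \<Rightarrow> bool" where
  "ordered_eigenvalues M \<alpha> \<longleftrightarrow>
     (\<forall>i j. 1 \<le> i \<and> i \<le> j \<and> j \<le> CARD('n) \<longrightarrow> \<alpha> j \<le> \<alpha> i) \<and>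
     (\<forall>x. det (mat x - M) = (\<Prod>i=1..CARD('n). x - \<alpha> i))"

definition quad :: "real^'n^'n \<Rightarrow> real^'n \<Rightarrow> real^'n \<Rightarrow> real" where
  "quad A g s = g \<bullet> s + (1/2) * (s \<bullet> (A *v s))"

definition trs_multiplier ::
  "real^'n^'n \<Rightarrow> real^'n \<Rightarrow> real \<Rightarrow> real^'n \<Rightarrow> real \<Rightarrow> bool" where
  "trs_multiplier A g \<Delta> s lam \<longleftrightarrow>
     lam \<ge> 0 \<and> norm s \<le> \<Delta> \<and> (A + mat lam) *v s = - g \<and>
     lam * (\<Delta> - norm s) = 0 \<and> pos_semidef (A + mat lam)"

definition krylov :: "real^'n^'n \<Rightarrow> real^'n \<Rightarrow> nat \<Rightarrow> (real^'n) set" where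
  "krylov A g k = span ((\<lambda>j. (((*v) A) ^^ j) g) ` {..k})"

definition k_max :: "real^'n^'n \<Rightarrow> real^'n \<Rightarrow> nat" where
  "k_max A g = (GREATEST k. dim (krylov A g k) = k + 1)"

text \<open>The symmetric Lanczos process, in terms of the unnormalized vectors \<open>r\<^sub>j\<close>: with
  \<open>\<beta>\<^sub>j = \<parallel>r\<^sub>j\<parallel>\<close> and \<open>q\<^sub>j = r\<^sub>j / \<beta>\<^sub>j\<close> (that is, \<open>sgn r\<^sub>j\<close>), one has \<open>r\<^sub>0 = g\<close> and
  \<open>r\<^sub>j\<^sub>+\<^sub>1 = A q\<^sub>j - (q\<^sub>j\<^sup>T A q\<^sub>j) q\<^sub>j - \<beta>\<^sub>j q\<^sub>j\<^sub>-\<^sub>1\<close>, without the last summand when \<open>j = 0\<close>.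
  After a breakdown (\<open>r\<^sub>j = 0\<close>) the values are meaningless.\<close>

fun lanczos_res :: "real^'n^'n \<Rightarrow> real^'n \<Rightarrow> nat \<Rightarrow> real^'n" where
  "lanczos_res A g 0 = g"
| "lanczos_res A g (Suc 0) = (let q = sgn g in A *v q - (q \<bullet> (A *v q)) *\<^sub>R q)"
| "lanczos_res A g (Suc (Suc j)) =
     (let q = sgn (lanczos_res A g (Suc j)) in
        A *v q - (q \<bullet> (A *v q)) *\<^sub>R q
          - norm (lanczos_res A g (Suc j)) *\<^sub>R sgn (lanczos_res A g j))"

text \<open>\<open>lanczos_vec A g j\<close> is column \<open>j\<close>, counted from 0, of every \<open>Q\<^sub>k\<close> with \<open>j \<le> k\<close>.\<close>

definition lanczos_vec :: "real^'n^'n \<Rightarrow> real^'n \<Rightarrow> nat \<Rightarrow> real^'n" where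
  "lanczos_vec A g j = sgn (lanczos_res A g j)"

text \<open>As their size \<open>k + 1\<close> varies, vectors and matrices in the coordinates of \<open>Q\<^sub>k\<close> are functions
  on indices, of which only the values at indices \<open>\<le> k\<close> matter. Then \<open>Q\<^sub>k h\<close> is
  \<open>lanczos_lift A g k h\<close>, the entries of \<open>T\<^sub>k = Q\<^sub>k\<^sup>T A Q\<^sub>k\<close> are \<open>lanczos_T A g i j\<close> with
  \<open>i, j \<le> k\<close>, the 2-norm of \<open>h\<close> is \<open>L2_set h {..k}\<close>, and the first unit vector has its 1 at
  index 0.\<close>

definition lanczos_lift :: "real^'n^'n \<Rightarrow> real^'n \<Rightarrow> nat \<Rightarrow> (nat \<Rightarrow> real) \<Rightarrow> real^'n" where
  "lanczos_lift A g k h = (\<Sum>j\<le>k. h j *\<^sub>R lanczos_vec A g j)"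

definition lanczos_T :: "real^'n^'n \<Rightarrow> real^'n \<Rightarrow> nat \<Rightarrow> nat \<Rightarrow> real" where
  "lanczos_T A g i j = lanczos_vec A g i \<bullet> (A *v lanczos_vec A g j)"

definition shifted_T :: "real^'n^'n \<Rightarrow> real^'n \<Rightarrow> real \<Rightarrow> nat \<Rightarrow> nat \<Rightarrow> real" where
  "shifted_T A g lam i j = lanczos_T A g i j + (if i = j then lam else 0)"

definition reduced_multiplier ::
  "real^'n^'n \<Rightarrow> real^'n \<Rightarrow> real \<Rightarrow> nat \<Rightarrow> (nat \<Rightarrow> real) \<Rightarrow> real \<Rightarrow> bool" where
  "reduced_multiplier A g \<Delta> k h lam \<longleftrightarrow>
     lam \<ge> 0 \<and> L2_set h {..k} \<le> \<Delta> \<and>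
     (\<forall>i\<le>k. (\<Sum>j\<le>k. shifted_T A g lam i j * h j) = - (norm g * (if i = 0 then 1 else 0))) \<and>
     lam * (\<Delta> - L2_set h {..k}) = 0 \<and>
     (\<forall>x. (\<Sum>i\<le>k. \<Sum>j\<le>k. x i * shifted_T A g lam i j * x j) \<ge> 0)"

end

theory Submission
  imports Defs
begin

text \<open>Since \<open>(A + \<lambda>\<^sub>o\<^sub>p\<^sub>t I) s\<^sub>o\<^sub>p\<^sub>t = - g\<close>, the residual equals
  \<open>(A + \<lambda>\<^sub>o\<^sub>p\<^sub>t I) (s\<^sub>k - s\<^sub>o\<^sub>p\<^sub>t) - (\<lambda>\<^sub>o\<^sub>p\<^sub>t - \<lambda>\<^sub>k) s\<^sub>k\<close>, and the positive definite matrix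
  \<open>A + \<lambda>\<^sub>o\<^sub>p\<^sub>t I\<close> has norm \<open>\<alpha>\<^sub>1 + \<lambda>\<^sub>o\<^sub>p\<^sub>t\<close>; the dropped second-order term only has to be
  nonnegative. So the substance is \<open>\<lambda>\<^sub>k \<le> \<lambda>\<^sub>o\<^sub>p\<^sub>t\<close>.

  To see this, conjugate the tridiagonal Lanczos matrix by \<open>diag (1, -1, 1, \<dots>)\<close>. Its off-diagonal
  entries become nonpositive, so its positive definite shifts are Stieltjes matrices and have
  nonnegative inverses. Let \<open>X\<close> and \<open>Y\<close> be the sign-flipped Lanczos coordinates of \<open>s\<^sub>k\<close> and
  \<open>s\<^sub>o\<^sub>p\<^sub>t\<close>. If \<open>\<lambda>\<^sub>k > \<lambda>\<^sub>o\<^sub>p\<^sub>t\<close>, comparing the two linear systems gives \<open>Y \<ge> X \<ge> 0\<close>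
  entrywise; both have norm \<open>\<Delta>\<close>, so \<open>X = Y\<close>, and then the systems force \<open>X = 0\<close>.\<close>

section \<open>Symmetric matrices\<close>

lemma mat_mult_vec: "mat c *v x = c *\<^sub>R (x :: real^'n)"
  by (simp add: vec_eq_iff matrix_vector_mult_def mat_def if_distrib if_distribR cong: if_cong)

lemma shift_mult_vec: "(A + mat c) *v x = A *v x + c *\<^sub>R (x :: real^'n)"
  by (simp add: matrix_vector_mult_add_rdistrib mat_mult_vec)

lemma inner_symmetric_matrix:
  fixes M :: "real^'n^'n"
  assumes "transpose M = M"
  shows "x \<bullet> (M *v y) = (M *v x) \<bullet> y"
  by (metis assms dot_lmul_matrix transpose_matrix_vector)

lemma transpose_mat: "transpose (mat c) = (mat c :: real^'n^'n)"
  by (auto simp: transpose_def mat_def vec_eq_iff)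

lemma transpose_add: "transpose (M + N) = transpose M + transpose (N :: real^'n^'n)"
  by (simp add: transpose_def vec_eq_iff)

lemma transpose_minus: "transpose (M - N) = transpose M - transpose (N :: real^'n^'n)"
  by (simp add: transpose_def vec_eq_iff)

text \<open>The form at \<open>x + t *\<^sub>R y\<close> is a polynomial in \<open>t\<close> of
  degree at most two that is never negative, which bounds its discriminant.\<close>

lemma pos_semidef_Cauchy_Schwarz:
  fixes M :: "real^'n^'n"
  assumes sym: "transpose M = M" and psd: "pos_semidef M"
  shows "(x \<bullet> (M *v y))\<^sup>2 \<le> (x \<bullet> (M *v x)) * (y \<bullet> (M *v y))"
proof -
  define a b c where "a = x \<bullet> (M *v x)" and "b = x \<bullet> (M *v y)" and "c = y \<bullet> (M *v y)"
  have quad: "a + 2 * t * b + t\<^sup>2 * c \<ge> 0" for t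
  proof -
    have "(x + t *\<^sub>R y) \<bullet> (M *v (x + t *\<^sub>R y)) = a + 2 * t * b + t\<^sup>2 * c"
      using inner_symmetric_matrix[OF sym, of y x]
      by (simp add: a_def b_def c_def matrix_vector_right_distrib matrix_vector_mult_scaleR
          inner_add_left inner_add_right power2_eq_square inner_commute algebra_simps)
    then show ?thesis using psd unfolding pos_semidef_def by metis
  qed
  have "c \<ge> 0" using psd by (simp add: c_def pos_semidef_def)
  have "b\<^sup>2 \<le> a * c"
  proof (cases "c = 0")
    case True
    have "b = 0"
    proof (rule ccontr)
      assume "b \<noteq> 0"
      \<comment> \<open>With \<open>c = 0\<close> the polynomial is affine; this \<open>t\<close>
        gives it the value -1.\<close>
      then show False using quad[of "- (a + 1) / (2 * b)"] True by (simp add: field_simps)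
    qed
    then show ?thesis using True by simp
  next
    case False
    then have "c > 0" using \<open>c \<ge> 0\<close> by simp
    \<comment> \<open>This \<open>t\<close> is the minimizer of the quadratic.\<close>
    then show ?thesis using quad[of "- b / c"]
      by (simp add: field_simps power2_eq_square)
  qed
  then show ?thesis by (simp add: a_def b_def c_def)
qed

lemma pos_semidef_kernel:
  fixes M :: "real^'n^'n"
  assumes "transpose M = M" "pos_semidef M" "v \<bullet> (M *v v) = 0"
  shows "M *v v = 0"
proof -
  have "((M *v v) \<bullet> (M *v v))\<^sup>2 \<le> 0"
    using pos_semidef_Cauchy_Schwarz[OF assms(1,2), of "M *v v" v] assms(3) by simp
  then show ?thesis by simp
qed

text \<open>Cauchy-Schwarz for the form, applied to \<open>y = M *v x\<close> and \<open>x\<close>,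
  bounds the fourth power of \<open>norm y\<close> by
  \<open>c\<^sup>2 * (norm y)\<^sup>2 * (norm x)\<^sup>2\<close>; cancelling
  \<open>(norm y)\<^sup>2\<close> leaves the claim. A Rayleigh bound thus controls the operator norm
  without diagonalization.\<close>

lemma pos_semidef_norm_le:
  fixes M :: "real^'n^'n"
  assumes sym: "transpose M = M" and psd: "pos_semidef M"
    and upper: "\<And>x. x \<bullet> (M *v x) \<le> c * (norm x)\<^sup>2"
  shows "norm (M *v x) \<le> c * norm x"
proof (cases "M *v x = 0")
  case True
  obtain b :: "real^'n" where "norm b = 1" using vector_choose_size[of 1] by auto
  then have "c \<ge> 0" using upper[of b] psd by (force simp: pos_semidef_def dest: spec[of _ b])
  then show ?thesis using True by simp
next
  case False
  define y where "y = M *v x"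
  have ny: "norm y > 0" using False by (simp add: y_def)
  have c0: "c \<ge> 0"
  proof -
    have "0 \<le> c * (norm y)\<^sup>2" using upper[of y] psd unfolding pos_semidef_def by (meson order_trans)
    then show ?thesis using ny by (simp add: zero_le_mult_iff)
  qed
  have "((norm y)\<^sup>2)\<^sup>2 = (y \<bullet> (M *v x))\<^sup>2"
    by (simp add: y_def power2_norm_eq_inner)
  also have "\<dots> \<le> (y \<bullet> (M *v y)) * (x \<bullet> (M *v x))"
    by (rule pos_semidef_Cauchy_Schwarz[OF sym psd])
  also have "\<dots> \<le> (c * (norm y)\<^sup>2) * (c * (norm x)\<^sup>2)"
    using psd c0 by (intro mult_mono upper) (auto simp: pos_semidef_def)
  finally have "(norm y)\<^sup>2 * (norm y)\<^sup>2 \<le> (norm y)\<^sup>2 * (c * norm x)\<^sup>2"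
    by (simp add: power2_eq_square mult_ac)
  moreover have "(norm y)\<^sup>2 > 0" using ny by simp
  ultimately have "(norm y)\<^sup>2 \<le> (c * norm x)\<^sup>2" by (rule mult_left_le_imp_le)
  then show ?thesis using c0 unfolding y_def by (metis mult_nonneg_nonneg norm_ge_zero power2_le_imp_le)
qed

text \<open>Let \<open>v\<close> maximize the form on the compact unit sphere, with maximum
  \<open>\<mu>\<close>. Then \<open>mat \<mu> - A\<close> is positive semidefinite and its form
  vanishes at \<open>v\<close>, so \<open>v\<close> lies in its kernel.\<close>

lemma symmetric_matrix_max_eigenvalue:
  fixes A :: "real^'n^'n"
  assumes sym: "transpose A = A"
  obtains v \<mu> where "norm v = 1" "A *v v = \<mu> *\<^sub>R v" "\<And>x. x \<bullet> (A *v x) \<le> \<mu> * (norm x)\<^sup>2"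
proof -
  let ?S = "sphere (0 :: real^'n) 1"
  have "?S \<noteq> {}" by simp
  moreover have "continuous_on ?S (\<lambda>x. x \<bullet> (A *v x))"
    by (intro continuous_intros matrix_vector_mult_linear_continuous_on)
  ultimately have "\<exists>v\<in>?S. \<forall>x\<in>?S. x \<bullet> (A *v x) \<le> v \<bullet> (A *v v)"
    by (rule continuous_attains_sup[OF compact_sphere])
  then obtain v where v: "v \<in> ?S" "\<And>x. x \<in> ?S \<Longrightarrow> x \<bullet> (A *v x) \<le> v \<bullet> (A *v v)"
    by blast
  define \<mu> where "\<mu> = v \<bullet> (A *v v)"
  have nv: "norm v = 1" using v(1) by simp
  have upper: "x \<bullet> (A *v x) \<le> \<mu> * (norm x)\<^sup>2" for x
  proof (cases "x = 0")
    case False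
    have "sgn x \<bullet> (A *v sgn x) \<le> \<mu>"
      using v(2)[of "sgn x"] False by (simp add: \<mu>_def norm_sgn)
    moreover have "x \<bullet> (A *v x) = (norm x)\<^sup>2 * (sgn x \<bullet> (A *v sgn x))"
      using False by (simp add: sgn_div_norm matrix_vector_mult_scaleR power2_eq_square field_simps)
    ultimately show ?thesis by (metis mult.commute mult_left_mono zero_le_power2)
  qed simp
  let ?M = "mat \<mu> - A"
  have M: "?M *v x = \<mu> *\<^sub>R x - A *v x" for x
    by (simp add: matrix_vector_mult_diff_rdistrib mat_mult_vec)
  have "?M *v v = 0"
  proof (rule pos_semidef_kernel)
    show "transpose ?M = ?M" by (simp add: transpose_minus transpose_mat sym)
    show "pos_semidef ?M"
      using upper by (simp add: pos_semidef_def M inner_diff_right power2_norm_eq_inner)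
    show "v \<bullet> (?M *v v) = 0"
      using nv by (simp add: M inner_diff_right norm_eq_1 flip: \<mu>_def)
  qed
  then have "A *v v = \<mu> *\<^sub>R v" by (simp add: M)
  then show ?thesis using that nv upper by blast
qed

text \<open>The maximum of the Rayleigh quotient is an eigenvalue, hence a root of the
  characteristic polynomial, hence some \<open>\<alpha> i\<close>; the ordering puts it below
  \<open>\<alpha> 1\<close>.\<close>

lemma Rayleigh_le_first_eigenvalue:
  fixes A :: "real^'n^'n"
  assumes sym: "transpose A = A" and ev: "ordered_eigenvalues A \<alpha>"
  shows "x \<bullet> (A *v x) \<le> \<alpha> 1 * (norm x)\<^sup>2"
proof -
  obtain v \<mu> where v: "norm v = 1" "A *v v = \<mu> *\<^sub>R v"
    and upper: "\<And>x. x \<bullet> (A *v x) \<le> \<mu> * (norm x)\<^sup>2"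
    using symmetric_matrix_max_eigenvalue[OF sym] by metis
  have "(mat \<mu> - A) *v v = 0"
    using v(2) by (simp add: matrix_vector_mult_diff_rdistrib mat_mult_vec)
  moreover have "v \<noteq> 0" using v(1) by auto
  ultimately have "det (mat \<mu> - A) = 0"
    by (metis invertible_det_nz invertible_left_inverse matrix_left_invertible_ker)
  then have "(\<Prod>i=1..CARD('n). \<mu> - \<alpha> i) = 0"
    using ev by (simp add: ordered_eigenvalues_def)
  then obtain i where i: "i \<in> {1..CARD('n)}" "\<mu> = \<alpha> i" by auto
  then have "\<mu> \<le> \<alpha> 1" using ev by (auto simp: ordered_eigenvalues_def)
  then show ?thesis using upper[of x] by (meson mult_right_mono order_trans zero_le_power2)
qed

text \<open>Split \<open>z = p - n\<close> into positive and negative parts and test the system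
  against \<open>n\<close>. In the mixed form of \<open>n\<close> and \<open>p\<close> the diagonal
  terms vanish and the others are nonpositive, so the form at \<open>n\<close> is nonpositive and
  definiteness forces \<open>n = 0\<close>.\<close>

lemma Stieltjes_inverse_nonneg:
  fixes b :: "'a \<Rightarrow> 'a \<Rightarrow> real"
  assumes fin: "finite I"
    and off: "\<And>i j. i \<in> I \<Longrightarrow> j \<in> I \<Longrightarrow> i \<noteq> j \<Longrightarrow> b i j \<le> 0"
    and pd: "\<And>x. (\<Sum>i\<in>I. \<Sum>j\<in>I. x i * b i j * x j) \<le> 0 \<Longrightarrow> (\<forall>i\<in>I. x i = 0)"
    and rhs: "\<And>i. i \<in> I \<Longrightarrow> (\<Sum>j\<in>I. b i j * z j) \<ge> 0"
    and i: "i \<in> I"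
  shows "z i \<ge> 0"
proof -
  define p where "p = (\<lambda>j. max (z j) 0)"
  define n where "n = (\<lambda>j. max (- z j) 0)"
  have z: "z j = p j - n j" for j by (simp add: p_def n_def max_def)
  have "(\<Sum>i\<in>I. \<Sum>j\<in>I. n i * b i j * n j)
      = (\<Sum>i\<in>I. \<Sum>j\<in>I. n i * b i j * p j) - (\<Sum>i\<in>I. n i * (\<Sum>j\<in>I. b i j * z j))"
    by (simp add: z sum_distrib_left algebra_simps flip: sum_subtractf)
  moreover have "n i * b i j * p j \<le> 0" if "i \<in> I" "j \<in> I" for i j
  proof (cases "i = j")
    case True
    then show ?thesis by (simp add: n_def p_def max_def)
  next
    case False
    then show ?thesis using off[OF that False]
      by (simp add: n_def p_def mult_nonneg_nonpos mult_nonpos_nonneg)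
  qed
  then have "(\<Sum>i\<in>I. \<Sum>j\<in>I. n i * b i j * p j) \<le> 0" by (intro sum_nonpos)
  moreover have "(\<Sum>i\<in>I. n i * (\<Sum>j\<in>I. b i j * z j)) \<ge> 0"
    using rhs by (intro sum_nonneg mult_nonneg_nonneg[OF _ rhs]) (auto simp: n_def)
  ultimately have "(\<Sum>i\<in>I. \<Sum>j\<in>I. n i * b i j * n j) \<le> 0" by linarith
  then have "n i = 0" using pd i by blast
  then show ?thesis by (simp add: n_def max_def split: if_splits)
qed

section \<open>The Lanczos process\<close>

context
  fixes A :: "real^'n^'n" and g :: "real^'n"
begin

abbreviation "r \<equiv> lanczos_res A g"
abbreviation "q \<equiv> lanczos_vec A g"
abbreviation "T \<equiv> lanczos_T A g"

text \<open>As \<open>sgn 0 = 0\<close>, this survives a breakdown, so the recurrence and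
  orthogonality hold at all indices.\<close>

lemma lanczos_res_eq: "r j = norm (r j) *\<^sub>R q j"
  by (cases "r j = 0") (auto simp: lanczos_vec_def sgn_div_norm)

lemma lanczos_res_inner_vec: "r j \<bullet> q j = norm (r j)"
  by (cases "r j = 0") (auto simp: lanczos_vec_def sgn_div_norm dot_square_norm power2_eq_square)

lemma norm_lanczos_vec: "r j \<noteq> 0 \<Longrightarrow> norm (q j) = 1"
  by (simp add: lanczos_vec_def norm_sgn)

lemma lanczos_recurrence:
  "A *v q j = r (Suc j) + T j j *\<^sub>R q j + (if j = 0 then 0 else norm (r j) *\<^sub>R q (j - 1))"
proof (cases j)
  case 0
  show ?thesis unfolding 0 by (simp add: lanczos_vec_def lanczos_T_def Let_def)
next
  case (Suc i)
  show ?thesis unfolding Suc lanczos_res.simps(3) Let_def lanczos_T_def lanczos_vec_def by simp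
qed

lemma mult_lanczos_vec_in_span: "A *v q j \<in> span (q ` {..Suc j})"
proof -
  have q: "q i \<in> span (q ` {..Suc j})" if "i \<le> Suc j" for i
    using that by (intro span_base) auto
  have "r (Suc j) \<in> span (q ` {..Suc j})"
    by (subst lanczos_res_eq) (intro span_scale q order_refl)
  then show ?thesis
    by (subst lanczos_recurrence) (simp add: span_add span_scale span_zero q)
qed

text \<open>Each application of \<open>A\<close> raises the highest Lanczos index by at most one.
  The inclusion makes the Krylov dimension a lower bound for the number of nonzero Lanczos
  vectors.\<close>

lemma krylov_subset: "krylov A g k \<subseteq> span (q ` {..k})"
proof -
  have "(((*v) A) ^^ j) g \<in> span (q ` {..j})" for j
  proof (induction j)
    case 0
    have "g = norm g *\<^sub>R q 0" using lanczos_res_eq[of 0] by simp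
    then show ?case by (metis atMost_iff funpow_0 image_eqI le_refl span_base span_scale)
  next
    case (Suc j)
    have "(*v) A ` span (q ` {..j}) \<subseteq> span (q ` {..Suc j})"
    proof -
      have "A *v q i \<in> span (q ` {..Suc j})" if "i \<le> j" for i
        using mult_lanczos_vec_in_span[of i] span_mono[of "q ` {..Suc i}" "q ` {..Suc j}"] that
        by (meson Suc_le_mono atMost_subset_iff image_mono subsetD)
      then have "(*v) A ` (q ` {..j}) \<subseteq> span (q ` {..Suc j})" by auto
      moreover have "(*v) A ` span (q ` {..j}) = span ((*v) A ` (q ` {..j}))"
        by (simp add: linear_span_image matrix_vector_mul_linear)
      ultimately show ?thesis by (metis span_minimal subspace_span)
    qed
    then show ?case using Suc by auto
  qed
  then have "(\<lambda>j. (((*v) A) ^^ j) g) ` {..k} \<subseteq> span (q ` {..k})"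
    by (smt (verit, best) atMost_iff atMost_subset_iff image_mono image_subset_iff span_mono subsetD)
  then show ?thesis unfolding krylov_def by (simp add: span_minimal subspace_span)
qed

text \<open>The greatest index exists: 0 qualifies since \<open>g \<noteq> 0\<close>, and the
  dimension of the whole space bounds all candidates.\<close>

lemma dim_krylov_k_max:
  assumes "g \<noteq> 0"
  shows "dim (krylov A g (k_max A g)) = k_max A g + 1"
  unfolding k_max_def
proof (rule GreatestI_nat)
  show "dim (krylov A g 0) = 0 + 1"
    using assms by (simp add: krylov_def dim_insert)
  show "k \<le> CARD('n)" if "dim (krylov A g k) = k + 1" for k
    using that dim_subset_UNIV_cart[of "krylov A g k"] by simp
qed

text \<open>If one of the \<open>k_max + 1\<close> Lanczos vectors were zero, the remaining ones
  would be too few to span a space of dimension \<open>k_max + 1\<close>.\<close>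

lemma lanczos_res_nonzero:
  assumes "g \<noteq> 0" "j \<le> k_max A g"
  shows "r j \<noteq> 0"
proof
  let ?m = "k_max A g"
  assume "r j = 0"
  then have "q j = 0" by (simp add: lanczos_vec_def)
  have "q ` {..?m} \<subseteq> insert 0 (q ` ({..?m} - {j}))" using \<open>q j = 0\<close> by auto
  then have "span (q ` {..?m}) \<subseteq> span (insert 0 (q ` ({..?m} - {j})))" by (rule span_mono)
  then have "krylov A g ?m \<subseteq> span (q ` ({..?m} - {j}))"
    using krylov_subset[of ?m] by simp
  then have "dim (krylov A g ?m) \<le> card (q ` ({..?m} - {j}))"
    by (intro dim_le_card) auto
  also have "\<dots> \<le> card ({..?m} - {j})" by (intro card_image_le) auto
  also have "\<dots> = ?m" using assms(2) by simp
  finally show False using dim_krylov_k_max[OF assms(1)] by simp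
qed

section \<open>Consequences of symmetry: orthogonality, tridiagonality, reduced systems\<close>

context
  assumes sym: "transpose A = A"
begin

text \<open>Strong induction through the recurrence for \<open>r (Suc n)\<close>. For
  \<open>i = n\<close> the diagonal coefficient cancels; for smaller \<open>i\<close>, symmetry
  moves \<open>A\<close> onto \<open>q i\<close>, whose image involves no index above
  \<open>Suc i\<close>, so only \<open>Suc i = n\<close> leaves a term, and the last summand of the
  recurrence removes it.\<close>

lemma lanczos_orthogonal_less: "i < j \<Longrightarrow> q i \<bullet> q j = 0"
proof (induction j arbitrary: i rule: less_induct)
  case (less j)
  then obtain n where n: "j = Suc n" by (cases j) auto
  have orth: "q a \<bullet> q b = 0" if "a \<le> n" "b \<le> n" "a \<noteq> b" for a b
    using less.IH[of a b] less.IH[of b a] that n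
    by (cases a b rule: linorder_cases) (auto simp: inner_commute)
  have rec: "q i \<bullet> r (Suc n) = q i \<bullet> (A *v q n) - T n n * (q i \<bullet> q n)
      - (if n = 0 then 0 else norm (r n) * (q i \<bullet> q (n - 1)))"
    by (simp add: lanczos_recurrence[of n] inner_add_right)
  have "q i \<bullet> r (Suc n) = 0"
  proof -
    consider "i = n" | "Suc i = n" | "Suc i < n" using less.prems n by linarith
    then show ?thesis
    proof cases
      case 1
      have "T n n * (q n \<bullet> q n) = T n n"
        using norm_lanczos_vec[of n]
        by (cases "r n = 0") (auto simp: norm_eq_1 lanczos_T_def lanczos_vec_def)
      then show ?thesis using rec 1 orth[of n "n - 1"] by (auto simp: lanczos_T_def)
    next
      case 2
      have "q i \<bullet> (A *v q n) = (A *v q i) \<bullet> q n"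
        by (rule inner_symmetric_matrix[OF sym])
      also have "\<dots> = r n \<bullet> q n"
        using orth[of i n] orth[of "i - 1" n] 2 by (auto simp: lanczos_recurrence[of i] inner_add_left)
      finally have 3: "q i \<bullet> (A *v q n) = norm (r n)" by (simp add: lanczos_res_inner_vec)
      \<comment> \<open>After a breakdown \<open>q i\<close> may be zero instead of a unit vector;
        then \<open>r n\<close> vanishes as well.\<close>
      have "norm (r n) * (q i \<bullet> q i) = norm (r n)"
      proof (cases "r i = 0")
        case True
        then have "q i = 0" by (simp add: lanczos_vec_def)
        then have "r n = 0" using 3 by simp
        then show ?thesis by simp
      next
        case False
        then show ?thesis using norm_lanczos_vec by (simp add: norm_eq_1)
      qed
      then show ?thesis using rec 3 2 orth[of i n] by auto
    next
      case 3
      have "q i \<bullet> (A *v q n) = (A *v q i) \<bullet> q n"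
        by (rule inner_symmetric_matrix[OF sym])
      also have "\<dots> = r (Suc i) \<bullet> q n"
        using orth[of i n] orth[of "i - 1" n] 3 by (auto simp: lanczos_recurrence[of i] inner_add_left)
      also have "\<dots> = 0"
        using orth[of "Suc i" n] 3 by (subst lanczos_res_eq) auto
      finally show ?thesis using rec 3 orth[of i n] orth[of i "n - 1"] by auto
    qed
  qed
  then show ?case by (simp add: n lanczos_vec_def sgn_div_norm)
qed

lemma lanczos_orthogonal: "i \<noteq> j \<Longrightarrow> q i \<bullet> q j = 0"
  using lanczos_orthogonal_less[of i j] lanczos_orthogonal_less[of j i]
  by (cases i j rule: linorder_cases) (auto simp: inner_commute)

text \<open>Otherwise there would be infinitely many nonzero, pairwise orthogonal vectors in a
  finite-dimensional space.\<close>

lemma lanczos_breakdown: "\<exists>n. r n = 0"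
proof (rule ccontr)
  assume "\<not> ?thesis"
  then have nz: "q j \<noteq> 0" for j by (simp add: lanczos_vec_def sgn_zero_iff)
  have inj: "inj q"
    by (rule injI) (metis nz lanczos_orthogonal inner_eq_zero_iff)
  have "pairwise orthogonal (range q)"
    by (auto simp: pairwise_def orthogonal_def intro!: lanczos_orthogonal)
  then have "independent (range q)" using nz by (intro pairwise_orthogonal_independent) auto
  then have "finite (range q)" by (rule independent_imp_finite)
  then show False using inj finite_imageD infinite_UNIV_nat by blast
qed

text \<open>Off the diagonal only neighbouring indices give nonzero entries. These are nonnegative,
  being built from norms of residuals, and \<open>i + j\<close> is odd there.\<close>

lemma lanczos_T_offdiag_sign:
  assumes "i \<noteq> j"
  shows "(-1) ^ (i + j) * T i j \<le> 0"
proof -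
  have "T i j = q i \<bullet> r (Suc j) + (if j = 0 then 0 else norm (r j) * (q i \<bullet> q (j - 1)))"
    unfolding lanczos_T_def[of A g i j] lanczos_recurrence[of j]
    using lanczos_orthogonal[OF assms] by (simp add: inner_add_right)
  also have "q i \<bullet> r (Suc j) = (if i = Suc j then norm (r (Suc j)) else 0)"
  proof (cases "i = Suc j")
    case False
    then show ?thesis using lanczos_orthogonal[OF False] by (subst lanczos_res_eq) simp
  qed (simp add: inner_commute lanczos_res_inner_vec)
  finally have T: "T i j = (if i = Suc j then norm (r (Suc j)) else 0)
      + (if j = 0 then 0 else norm (r j) * (q i \<bullet> q (j - 1)))" .
  consider "i = Suc j" | "j = Suc i" | "i \<noteq> Suc j" "j \<noteq> Suc i" by blast
  then show ?thesis
  proof cases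
    case 1
    then show ?thesis using T lanczos_orthogonal[of i "j - 1"] by (auto simp flip: power_Suc)
  next
    case 2
    then show ?thesis using T by auto
  next
    case 3
    then show ?thesis using T lanczos_orthogonal[of i "j - 1"] by auto
  qed
qed

lemma norm_lanczos_lift:
  assumes "\<And>j. j \<le> k \<Longrightarrow> r j \<noteq> 0"
  shows "(norm (lanczos_lift A g k x))\<^sup>2 = (\<Sum>j\<le>k. (x j)\<^sup>2)"
proof -
  have "(norm (lanczos_lift A g k x))\<^sup>2 = (\<Sum>j\<le>k. (norm (x j *\<^sub>R q j))\<^sup>2)"
    unfolding lanczos_lift_def
    by (rule norm_sum_Pythagorean)
      (auto simp: pairwise_def orthogonal_def intro!: lanczos_orthogonal)
  also have "\<dots> = (\<Sum>j\<le>k. (x j)\<^sup>2)"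
    using assms norm_lanczos_vec by (intro sum.cong) auto
  finally show ?thesis .
qed

text \<open>The shifted reduced matrix is the compression of \<open>A + mat \<mu>\<close> to the
  Lanczos vectors; this passes definiteness from the full matrix to it.\<close>

lemma shifted_T_form:
  assumes "\<And>j. j \<le> k \<Longrightarrow> r j \<noteq> 0"
  shows "(\<Sum>i\<le>k. \<Sum>j\<le>k. x i * shifted_T A g \<mu> i j * x j)
    = lanczos_lift A g k x \<bullet> ((A + mat \<mu>) *v lanczos_lift A g k x)"
proof -
  let ?L = "lanczos_lift A g k x"
  have "?L \<bullet> (A *v ?L) = (\<Sum>i\<le>k. \<Sum>j\<le>k. x i * T i j * x j)"
  proof -
    have "q i \<bullet> (A *v ?L) = (\<Sum>j\<le>k. T i j * x j)" for i
      by (simp add: lanczos_lift_def lanczos_T_def linear_sum[OF matrix_vector_mul_linear]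
          inner_sum_right matrix_vector_mult_scaleR mult.commute)
    moreover have "?L \<bullet> w = (\<Sum>i\<le>k. x i * (q i \<bullet> w))" for w
      by (simp add: lanczos_lift_def inner_sum_left)
    ultimately show ?thesis by (simp add: sum_distrib_left mult.assoc)
  qed
  moreover have "(\<Sum>i\<le>k. \<Sum>j\<le>k. x i * (if i = j then \<mu> else 0) * x j) = \<mu> * (\<Sum>j\<le>k. (x j)\<^sup>2)"
    by (simp add: if_distrib if_distribR power2_eq_square sum_distrib_left mult_ac cong: if_cong)
  ultimately show ?thesis
    by (simp add: shift_mult_vec inner_add_right power2_norm_eq_inner[symmetric]
        norm_lanczos_lift[OF assms] shifted_T_def distrib_left distrib_right sum.distrib)
qed

text \<open>Expand the squared distance from \<open>y\<close> to its projection. This bounds the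
  coordinates of the full solution even if it lies outside the span.\<close>

lemma lanczos_Bessel:
  assumes "\<And>j. j \<le> k \<Longrightarrow> r j \<noteq> 0"
  shows "(\<Sum>j\<le>k. (q j \<bullet> y)\<^sup>2) \<le> (norm y)\<^sup>2"
proof -
  let ?L = "lanczos_lift A g k (\<lambda>j. q j \<bullet> y)"
  have "?L \<bullet> y = (\<Sum>j\<le>k. (q j \<bullet> y)\<^sup>2)"
    by (simp add: lanczos_lift_def inner_sum_left power2_eq_square)
  moreover have "(norm (y - ?L))\<^sup>2 = (norm y)\<^sup>2 - 2 * (?L \<bullet> y) + (norm ?L)\<^sup>2"
    by (simp add: power2_norm_eq_inner inner_diff_left inner_diff_right inner_commute)
  moreover have "(norm (y - ?L))\<^sup>2 \<ge> 0" by simp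
  ultimately show ?thesis using norm_lanczos_lift[OF assms, of k "\<lambda>j. q j \<bullet> y"] by simp
qed

text \<open>Breakdown makes the span of the Lanczos vectors \<open>A\<close>-invariant, so the coordinates of the
  full solution solve the reduced system, without knowing that the solution lies in the span.\<close>

lemma reduced_system_at_breakdown:
  assumes nz: "\<And>j. j \<le> m \<Longrightarrow> r j \<noteq> 0" and br: "r (Suc m) = 0"
    and y: "(A + mat \<mu>) *v y = - g" and i: "i \<le> m"
  shows "(\<Sum>j\<le>m. shifted_T A g \<mu> i j * (q j \<bullet> y)) = - (norm g * (if i = 0 then 1 else 0))"
proof -
  have expand: "A *v q i = (\<Sum>j\<le>m. T j i *\<^sub>R q j)"
  proof -
    have "A *v q i \<in> span (q ` {..m})"
    proof (cases "i = m")
      case True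
      have "q j \<in> span (q ` {..m})" if "j \<le> m" for j
        using that by (intro span_base) auto
      then show ?thesis unfolding True
        by (subst lanczos_recurrence) (simp add: br span_add span_scale span_zero del: lanczos_res.simps)
    next
      case False
      then show ?thesis using i mult_lanczos_vec_in_span[of i] span_mono[of "q ` {..Suc i}" "q ` {..m}"]
        by (meson Suc_leI atMost_subset_iff image_mono le_neq_implies_less subsetD)
    qed
    \<comment> \<open>The error of the expansion lies in the span and is orthogonal to it, hence to
      itself.\<close>
    then have d: "A *v q i - (\<Sum>j\<le>m. T j i *\<^sub>R q j) \<in> span (q ` {..m})" (is "?d \<in> _")
      by (intro span_diff span_sum span_scale[OF span_base]) auto
    have "q l \<bullet> ?d = 0" if "l \<le> m" for l
    proof -
      have "(\<Sum>j\<le>m. T j i * (q l \<bullet> q j)) = (\<Sum>j\<le>m. if j = l then T j i else 0)"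
        using lanczos_orthogonal norm_lanczos_vec[OF nz] that
        by (intro sum.cong) (auto simp: norm_eq_1)
      then show ?thesis using that
        by (simp add: inner_diff_right inner_sum_right lanczos_T_def)
    qed
    then have "orthogonal ?d ?d"
      by (intro orthogonal_to_span[OF d]) (auto simp: orthogonal_def inner_commute)
    then show ?thesis by (simp add: orthogonal_self)
  qed
  have "(\<Sum>j\<le>m. shifted_T A g \<mu> i j * (q j \<bullet> y))
      = (\<Sum>j\<le>m. T i j * (q j \<bullet> y)) + (\<Sum>j\<le>m. if i = j then \<mu> * (q j \<bullet> y) else 0)"
    unfolding sum.distrib[symmetric]
    by (intro sum.cong) (auto simp: shifted_T_def distrib_right)
  also have "\<dots> = (A *v q i) \<bullet> y + \<mu> * (q i \<bullet> y)"
  proof -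
    have "T i j = T j i" for j
      using inner_symmetric_matrix[OF sym, of "q i" "q j"] by (simp add: lanczos_T_def inner_commute)
    then show ?thesis using i by (simp add: expand inner_sum_left)
  qed
  also have "\<dots> = q i \<bullet> ((A + mat \<mu>) *v y)"
    by (simp add: shift_mult_vec inner_add_right inner_symmetric_matrix[OF sym])
  also have "\<dots> = - (q i \<bullet> g)" by (simp add: y)
  also have "q i \<bullet> g = norm g * (if i = 0 then 1 else 0)"
  proof (cases "i = 0")
    case True
    then show ?thesis using lanczos_res_inner_vec[of 0] by (simp add: inner_commute)
  next
    case False
    have "q i \<bullet> (norm (r 0) *\<^sub>R q 0) = 0"
      unfolding inner_scaleR_right lanczos_orthogonal[OF False] by simp
    then show ?thesis using False unfolding lanczos_res_eq[of 0, symmetric] by simp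
  qed
  finally show ?thesis .
qed

lemma sign_flipped_inverse_nonneg:
  assumes nz: "\<And>j. j \<le> k \<Longrightarrow> r j \<noteq> 0" and pd: "pos_def (A + mat \<mu>)"
    and rhs: "\<And>i. i \<le> k \<Longrightarrow> (\<Sum>j\<le>k. (-1) ^ (i + j) * shifted_T A g \<mu> i j * z j) \<ge> 0"
    and i: "i \<le> k"
  shows "z i \<ge> 0"
proof (rule Stieltjes_inverse_nonneg[where I = "{..k}" and b = "\<lambda>i j. (-1) ^ (i + j) * shifted_T A g \<mu> i j"])
  show "(-1) ^ (i + j) * shifted_T A g \<mu> i j \<le> 0" if "i \<noteq> j" for i j
    using lanczos_T_offdiag_sign[OF that] that by (simp add: shifted_T_def)
  fix x :: "nat \<Rightarrow> real"
  assume le: "(\<Sum>i\<in>{..k}. \<Sum>j\<in>{..k}. x i * ((-1) ^ (i + j) * shifted_T A g \<mu> i j) * x j) \<le> 0"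
  \<comment> \<open>Moving the signs from the matrix into the vector turns the flipped form into the
    form of \<open>A + mat \<mu>\<close> at a lifted vector.\<close>
  define x' where "x' = (\<lambda>i. (-1) ^ i * x i)"
  let ?L = "lanczos_lift A g k x'"
  have "?L \<bullet> ((A + mat \<mu>) *v ?L) \<le> 0"
    using le by (simp add: shifted_T_form[OF nz, symmetric] x'_def power_add mult_ac)
  then have "?L = 0" using pd unfolding pos_def_def by (meson not_less)
  then have "(\<Sum>j\<le>k. (x' j)\<^sup>2) = 0" using norm_lanczos_lift[OF nz, of k x'] by simp
  then show "\<forall>i\<in>{..k}. x i = 0" by (simp add: sum_nonneg_eq_0_iff x'_def)
qed (use rhs i in auto)

section \<open>Comparison of the multipliers\<close>

text \<open>The two systems have different sizes: \<open>k + 1\<close> for the reduced problem, and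
  \<open>m + 1\<close>, with \<open>m\<close> the last index before breakdown, for the full one.
  They are compared in size \<open>m + 1\<close> after padding the reduced solution with
  zeros.\<close>

lemma reduced_multiplier_le:
  assumes g: "g \<noteq> 0" and \<Delta>: "\<Delta> > 0" and k: "k \<le> k_max A g"
    and y: "(A + mat \<mu>) *v y = - g" "norm y \<le> \<Delta>" and pd: "pos_def (A + mat \<mu>)"
    and red: "reduced_multiplier A g \<Delta> k h lam" and norm_h: "L2_set h {..k} = \<Delta>"
  shows "lam \<le> \<mu>"
proof (rule ccontr)
  assume "\<not> lam \<le> \<mu>"
  then have lt: "\<mu> < lam" by simp
  \<comment> \<open>The subtraction is not truncated: the first zero residual comes after index
    \<open>k_max A g\<close>.\<close>
  define m where "m = (LEAST n. r n = 0) - 1"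
  have "r (LEAST n. r n = 0) = 0" using lanczos_breakdown by (rule LeastI_ex)
  moreover from this have kL: "k_max A g < (LEAST n. r n = 0)"
    using lanczos_res_nonzero[OF g] by (meson not_less)
  ultimately have br: "r (Suc m) = 0" by (simp add: m_def)
  have nz: "r j \<noteq> 0" if "j \<le> m" for j
    using that not_less_Least[of j "\<lambda>n. r n = 0"] kL by (auto simp: m_def)
  have km: "k \<le> m" using k kL by (simp add: m_def)
  \<comment> \<open>The leading minus makes the right-hand side \<open>e\<close> of both flipped
    systems nonnegative.\<close>
  define X where "X = (\<lambda>i. if i \<le> k then - ((-1) ^ i * h i) else 0)"
  define Y where "Y = (\<lambda>i. - ((-1) ^ i * (q i \<bullet> y)))"
  define e where "e = (\<lambda>i::nat. norm g * (if i = 0 then 1 else 0))"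
  let ?b = "\<lambda>\<nu> i j. (-1) ^ (i + j) * shifted_T A g \<nu> i j"
  have flip: "(\<Sum>j\<le>l. ?b \<nu> i j * - ((-1) ^ j * u j)) = e i"
    if "(\<Sum>j\<le>l. shifted_T A g \<nu> i j * u j) = - (norm g * (if i = 0 then 1 else 0))" for l \<nu> i u
  proof -
    have "(\<Sum>j\<le>l. ?b \<nu> i j * - ((-1) ^ j * u j)) = - ((-1) ^ i * (\<Sum>j\<le>l. shifted_T A g \<nu> i j * u j))"
      by (simp add: sum_distrib_left power_add mult_ac flip: sum_negf)
    also have "\<dots> = e i" using that by (simp add: e_def)
    finally show ?thesis .
  qed
  have sysX: "(\<Sum>j\<le>k. ?b lam i j * X j) = e i" if "i \<le> k" for i
  proof -
    have "(\<Sum>j\<le>k. ?b lam i j * X j) = (\<Sum>j\<le>k. ?b lam i j * - ((-1) ^ j * h j))"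
      by (intro sum.cong) (auto simp: X_def)
    also have "\<dots> = e i"
      using red that by (intro flip) (simp add: reduced_multiplier_def)
    finally show ?thesis .
  qed
  have sysY: "(\<Sum>j\<le>m. ?b \<mu> i j * Y j) = e i" if "i \<le> m" for i
    unfolding Y_def by (intro flip reduced_system_at_breakdown nz br y(1) that)
  have pd': "pos_def (A + mat lam)"
    unfolding pos_def_def
  proof (intro allI impI)
    fix x :: "real^'n"
    assume "x \<noteq> 0"
    then have "0 < x \<bullet> ((A + mat \<mu>) *v x)" using pd by (simp add: pos_def_def)
    also have "\<dots> \<le> x \<bullet> ((A + mat lam) *v x)"
      using lt by (simp add: shift_mult_vec inner_add_right mult_right_mono)
    finally show "0 < x \<bullet> ((A + mat lam) *v x)" .
  qed
  have X0: "X i \<ge> 0" for i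
  proof (cases "i \<le> k")
    case True
    show ?thesis
      by (rule sign_flipped_inverse_nonneg[where k = k and \<mu> = lam])
        (use nz km pd' sysX True in \<open>auto simp: e_def\<close>)
  qed (simp add: X_def)
  have restrict: "(\<Sum>j\<le>m. ?b \<mu> i j * X j) = (\<Sum>j\<le>k. ?b \<mu> i j * X j)" for i
    using km by (intro sum.mono_neutral_right) (auto simp: X_def)
  have diff: "(\<Sum>j\<le>m. ?b \<mu> i j * (Y j - X j)) = e i - (\<Sum>j\<le>k. ?b \<mu> i j * X j)" if "i \<le> m" for i
    using sysY[OF that] restrict[of i] by (simp add: right_diff_distrib sum_subtractf)
  \<comment> \<open>In these rows both systems have right-hand side \<open>e i\<close>, so only the
    difference of the shifts remains.\<close>
  have diff_low: "(\<Sum>j\<le>m. ?b \<mu> i j * (Y j - X j)) = (lam - \<mu>) * X i" if "i \<le> k" for i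
  proof -
    have "(\<Sum>j\<le>k. ?b lam i j * X j) - (\<Sum>j\<le>k. ?b \<mu> i j * X j)
        = (\<Sum>j\<le>k. if i = j then (lam - \<mu>) * X j else 0)"
      unfolding sum_subtractf[symmetric]
      by (intro sum.cong) (auto simp: shifted_T_def algebra_simps)
    also have "\<dots> = (lam - \<mu>) * X i" using that by simp
    finally show ?thesis using diff[of i] sysX[OF that] km that by simp
  qed
  have "(\<Sum>j\<le>m. ?b \<mu> i j * (Y j - X j)) \<ge> 0" if "i \<le> m" for i
  proof (cases "i \<le> k")
    case True
    then show ?thesis using diff_low[OF True] X0[of i] lt by simp
  next
    case False
    \<comment> \<open>Below row \<open>k\<close> the padded \<open>X\<close> satisfies no equation,
      but it meets only off-diagonal entries of the row, which are nonpositive.\<close>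
    have "(\<Sum>j\<le>k. ?b \<mu> i j * X j) \<le> 0"
    proof (rule sum_nonpos, rule mult_nonpos_nonneg[OF _ X0])
      fix j
      assume "j \<in> {..k}"
      then have "i \<noteq> j" using False by auto
      then show "?b \<mu> i j \<le> 0"
        using lanczos_T_offdiag_sign[of i j] by (simp add: shifted_T_def)
    qed
    moreover have "e i \<ge> 0" by (simp add: e_def)
    ultimately show ?thesis using diff[OF that] by linarith
  qed
  then have XY: "X i \<le> Y i" if "i \<le> m" for i
    using sign_flipped_inverse_nonneg[where k = m and \<mu> = \<mu> and z = "\<lambda>j. Y j - X j"] nz pd that
    by simp
  have sumX: "(\<Sum>i\<le>m. (X i)\<^sup>2) = \<Delta>\<^sup>2"
  proof -
    have "(\<Sum>i\<le>m. (X i)\<^sup>2) = (\<Sum>i\<le>k. (X i)\<^sup>2)"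
      using km by (intro sum.mono_neutral_right) (auto simp: X_def)
    also have "\<dots> = (\<Sum>i\<le>k. (h i)\<^sup>2)"
      by (intro sum.cong) (auto simp: X_def power_mult_distrib simp flip: power_mult)
    also have "\<dots> = \<Delta>\<^sup>2"
      unfolding norm_h[symmetric] L2_set_def by (simp add: sum_nonneg)
    finally show ?thesis .
  qed
  have "(\<Sum>i\<le>m. (Y i)\<^sup>2) = (\<Sum>i\<le>m. (q i \<bullet> y)\<^sup>2)"
    by (simp add: Y_def power_mult_distrib flip: power_mult)
  also have "\<dots> \<le> (norm y)\<^sup>2" by (rule lanczos_Bessel[OF nz])
  also have "\<dots> \<le> \<Delta>\<^sup>2" using y(2) by (simp add: power_mono)
  \<comment> \<open>Every summand is nonnegative because \<open>0 \<le> X i \<le> Y i\<close>, so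
    all of them vanish and \<open>X\<close> and \<open>Y\<close> agree.\<close>
  finally have "(\<Sum>i\<le>m. (Y i)\<^sup>2 - (X i)\<^sup>2) \<le> 0" by (simp add: sum_subtractf sumX)
  moreover have sq: "(X i)\<^sup>2 \<le> (Y i)\<^sup>2" if "i \<le> m" for i
    using XY[OF that] X0[of i] by (simp add: power_mono)
  ultimately have "(\<Sum>i\<le>m. (Y i)\<^sup>2 - (X i)\<^sup>2) = 0"
    by (intro antisym sum_nonneg) auto
  then have "(Y i)\<^sup>2 = (X i)\<^sup>2" if "i \<le> m" for i
    using that sq by (subst (asm) sum_nonneg_eq_0_iff) auto
  then have eq: "Y i = X i" if "i \<le> m" for i
    using that XY[OF that] X0[of i] by (metis order_trans power2_eq_imp_eq)
  have "X i = 0" for i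
  proof (cases "i \<le> k")
    case True
    \<comment> \<open>With \<open>Y = X\<close> the left side of \<open>diff_low\<close> is zero,
      while \<open>lam - \<mu>\<close> is positive.\<close>
    then show ?thesis using diff_low[OF True] eq lt by simp
  qed (simp add: X_def)
  then show False using sumX \<Delta> by simp
qed

end

end

section \<open>The residual bound\<close>

theorem theorem5p5:
  fixes A :: "real^'n^'n" and g s_opt :: "real^'n"
    and \<alpha> :: "nat \<Rightarrow> real" and \<Delta> lam_opt :: real
    and s :: "nat \<Rightarrow> real^'n" and h :: "nat \<Rightarrow> nat \<Rightarrow> real" and lam :: "nat \<Rightarrow> real"
  assumes "transpose A = A" and "invertible A"
    and "ordered_eigenvalues A \<alpha>"
    and "g \<noteq> 0" and "\<Delta> > 0"
    and "is_arg_min (quad A g) (\<lambda>x. norm x \<le> \<Delta>) s_opt"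
    and "trs_multiplier A g \<Delta> s_opt lam_opt"
    and "pos_def (A + mat lam_opt)"
    and "\<And>k. k \<le> k_max A g \<Longrightarrow> s k = lanczos_lift A g k (h k)"
    and "\<And>k. k \<le> k_max A g \<Longrightarrow>
           is_arg_min (quad A g) (\<lambda>x. x \<in> krylov A g k \<and> norm x \<le> \<Delta>) (s k)"
    and "\<And>k. k \<le> k_max A g \<Longrightarrow> reduced_multiplier A g \<Delta> k (h k) (lam k)"
    and "norm s_opt = \<Delta>"
    and "\<And>k. k \<le> k_max A g \<Longrightarrow> norm (s k) = \<Delta>"
    and "\<And>k. k \<le> k_max A g \<Longrightarrow> lam k > 0"
  shows "\<forall>k \<le> k_max A g.
           norm ((A + mat (lam k)) *v s k + g)
             \<le> (lam_opt - lam k) * \<Delta> + (\<alpha> 1 + lam_opt) * norm (s_opt - s k)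
                + (lam_opt - lam k) * norm (s_opt - s k)"
proof (intro allI impI)
  fix k
  assume k: "k \<le> k_max A g"
  let ?B = "A + mat lam_opt"
  have opt: "?B *v s_opt = - g" using assms(7) by (simp add: trs_multiplier_def)
  \<comment> \<open>Complementary slackness with \<open>lam k > 0\<close> puts the reduced solution
    on the boundary.\<close>
  have "L2_set (h k) {..k} = \<Delta>"
    using assms(11,14)[OF k] by (simp add: reduced_multiplier_def)
  then have le: "lam k \<le> lam_opt"
    using reduced_multiplier_le[OF assms(1,4,5) k opt _ assms(8) assms(11)[OF k]] assms(12) by simp
  have "norm (?B *v x) \<le> (\<alpha> 1 + lam_opt) * norm x" for x
  proof (rule pos_semidef_norm_le)
    show "transpose ?B = ?B" by (simp add: transpose_add transpose_mat assms(1))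
    show "pos_semidef ?B" using assms(7) by (simp add: trs_multiplier_def)
    show "x \<bullet> (?B *v x) \<le> (\<alpha> 1 + lam_opt) * (norm x)\<^sup>2" for x
      using Rayleigh_le_first_eigenvalue[OF assms(1,3), of x]
      by (simp add: shift_mult_vec inner_add_right power2_norm_eq_inner distrib_right)
  qed
  then have B: "norm (?B *v (s k - s_opt)) \<le> (\<alpha> 1 + lam_opt) * norm (s_opt - s k)"
    by (metis norm_minus_commute)
  \<comment> \<open>Here \<open>g\<close> is replaced by \<open>- (?B *v s_opt)\<close>, and the
    shift \<open>lam k\<close> is written as \<open>lam_opt\<close> minus the gap.\<close>
  have "(A + mat (lam k)) *v s k + g = ?B *v (s k - s_opt) - (lam_opt - lam k) *\<^sub>R s k"
    using opt by (simp add: matrix_vector_mult_diff_distrib shift_mult_vec scaleR_left_diff_distrib)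
  then have "norm ((A + mat (lam k)) *v s k + g)
      \<le> norm (?B *v (s k - s_opt)) + norm ((lam_opt - lam k) *\<^sub>R s k)"
    by (metis norm_triangle_ineq4)
  also have "norm ((lam_opt - lam k) *\<^sub>R s k) = (lam_opt - lam k) * \<Delta>"
    using le assms(13)[OF k] by simp
  moreover have "0 \<le> (lam_opt - lam k) * norm (s_opt - s k)" using le by simp
  ultimately show "norm ((A + mat (lam k)) *v s k + g)
             \<le> (lam_opt - lam k) * \<Delta> + (\<alpha> 1 + lam_opt) * norm (s_opt - s k)
                + (lam_opt - lam k) * norm (s_opt - s k)"
    using B by linarith
qed

end
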